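(* Let $\mathcal L$ be a finite, bounded, atomic and graded lattice and let $\mathcal P$ be a geometric lattice with $\mathrm{rank}(\mathcal P)=\mathrm{rank}(\mathcal L)$. Let $f':A(\mathcal L)\to A(\mathcal P)$ be a bijection. Then $f'$ can be extended to a rank-preserving order embedding $f:\mathcal L\to\mathcal P$ if and only if both of the following hold: (i) $f'(I)\in I(\mathcal P)$ for every $I\in I(\mathcal L)$; (ii) $f'(A)\notin I(\mathcal P)$ for every set of atoms $A\subseteq A(\mathcal L)$ with $|A|>\mathrm{rank}\left(\bigvee A\right)$.
   Context: All lattices are finite. A lattice is bounded if it has a least element $\hat 0$ and a greatest element $\hat 1$. It is graded if it is bounded and has a rank function $\mathrm{rank}$ with $\mathrm{rank}(\hat 0)=0$, order-preserving, and with $\mathrm{rank}(Y)=\mathrm{rank}(X)+1$ whenever $Y$ covers $X$; the rank of the lattice is $\mathrm{rank}(\hat 1)$. An atom is an element covering $\hat 0$; $A(\mathcal L)$ denotes the set of atoms. The lattice is atomic if every element is a join of atoms. For a linear order $\omega$ on $A(\mathcal L)$, a nonempty set $D\subseteq A(\mathcal L)$ is called bounded below (BB) if there is an atom $a$ which is strictly smaller than every $d\in D$ in the order $\omega$ and satisfies $a\le \bigvee D$ in $\mathcal L$. A set of atoms is NBB with respect to $\omega$ if it contains no BB subset. $I(\mathcal L)$ denotes the family of all subsets of $A(\mathcal L)$ that are NBB with respect to at least one linear order on $A(\mathcal L)$. For a geometric lattice $\mathcal P$ (the lattice of flats of a simple matroid), $I(\mathcal P)$ is defined in the same way. A rank-preserving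 order embedding $f:\mathcal L\to\mathcal P$ is a map with $x\le y\iff f(x)\le f(y)$ and $\mathrm{rank}(f(x))=\mathrm{rank}(x)$ for all $x,y$. For a set $S$ of atoms, $f'(S)=\{f'(s):s\in S\}$. *)

theory Defs
  imports Main
begin

text \<open>
  Finite lattices are types of sort \<open>{finite, complete_lattice}\<close>: a finite nonempty lattice is
  bounded and complete, and \<^term>\<open>Sup\<close> is the finite join, with \<^term>\<open>Sup {} = bot\<close>.
\<close>

definition covers :: "'a::order \<Rightarrow> 'a \<Rightarrow> bool"
  where "covers y x \<longleftrightarrow> x < y \<and> (\<nexists>z. x < z \<and> z < y)"

definition atoms :: "'a::order_bot set"
  where "atoms = {a. covers a bot}"

definition is_rank_function :: "('a::order_bot \<Rightarrow> nat) \<Rightarrow> bool"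
  where "is_rank_function r \<longleftrightarrow>
    r bot = 0 \<and> mono r \<and> (\<forall>x y. covers y x \<longrightarrow> r y = r x + 1)"

definition graded_lattice :: "'a::{finite,complete_lattice} itself \<Rightarrow> bool"
  where "graded_lattice TYPE('a) \<longleftrightarrow> (\<exists>r :: 'a \<Rightarrow> nat. is_rank_function r)"

text \<open>
  A finite lattice has at most one rank function (lemma \<open>lattice_rank_eq\<close> below), so this
  is meaningful for every graded lattice, in particular for every geometric one.
\<close>

definition lattice_rank :: "'a::{finite,complete_lattice} \<Rightarrow> nat"
  where "lattice_rank = (THE r. is_rank_function r)"

definition atomic_lattice :: "'a::{finite,complete_lattice} itself \<Rightarrow> bool"
  where "atomic_lattice TYPE('a) \<longleftrightarrow> (\<forall>x :: 'a. \<exists>S \<subseteq> atoms. x = Sup S)"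

locale matroid =
  fixes E :: "'e set" and indep :: "'e set \<Rightarrow> bool"
  assumes finite_ground: "finite E"
    and indep_subset_ground: "indep X \<Longrightarrow> X \<subseteq> E"
    and indep_empty: "indep {}"
    and indep_hereditary: "indep Y \<Longrightarrow> X \<subseteq> Y \<Longrightarrow> indep X"
    and indep_augment:
      "indep X \<Longrightarrow> indep Y \<Longrightarrow> card X < card Y \<Longrightarrow> \<exists>e \<in> Y - X. indep (insert e X)"
begin

definition matroid_rank :: "'e set \<Rightarrow> nat"
  where "matroid_rank X = Max (card ` {I. I \<subseteq> X \<and> indep I})"

definition flat :: "'e set \<Rightarrow> bool"
  where "flat F \<longleftrightarrow>
    F \<subseteq> E \<and> (\<forall>e \<in> E - F. matroid_rank F < matroid_rank (insert e F))"

end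

text \<open>No loops (the case \<open>x = y\<close>) and no parallel pairs.\<close>

locale simple_matroid = matroid +
  assumes simple: "x \<in> E \<Longrightarrow> y \<in> E \<Longrightarrow> indep {x, y}"

text \<open>
  The lattice of flats of a simple matroid, ordered by inclusion, up to isomorphism.  Taking the
  ground set inside \<^typ>\<open>nat\<close> is no restriction, since ground sets are finite.
\<close>

definition geometric_lattice :: "'a::{finite,complete_lattice} itself \<Rightarrow> bool"
  where "geometric_lattice TYPE('a) \<longleftrightarrow>
    (\<exists>(E :: nat set) indep (\<phi> :: 'a \<Rightarrow> nat set).
      simple_matroid E indep \<and>
      bij_betw \<phi> UNIV {F. matroid.flat E indep F} \<and>
      (\<forall>x y. x \<le> y \<longleftrightarrow> \<phi> x \<subseteq> \<phi> y))"

text \<open>\<^term>\<open>(a, d) \<in> \<omega>\<close> is the reflexive order \<open>a \<le> d\<close>.\<close>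

definition bounded_below :: "'a::complete_lattice rel \<Rightarrow> 'a set \<Rightarrow> bool"
  where "bounded_below \<omega> D \<longleftrightarrow> D \<noteq> {} \<and> D \<subseteq> atoms \<and>
    (\<exists>a \<in> atoms. (\<forall>d \<in> D. (a, d) \<in> \<omega> \<and> a \<noteq> d) \<and> a \<le> Sup D)"

definition NBB :: "'a::complete_lattice rel \<Rightarrow> 'a set \<Rightarrow> bool"
  where "NBB \<omega> S \<longleftrightarrow> S \<subseteq> atoms \<and> \<not> (\<exists>D \<subseteq> S. bounded_below \<omega> D)"

definition NBB_sets :: "'a::complete_lattice set set"
  where "NBB_sets = {S. S \<subseteq> atoms \<and> (\<exists>\<omega>. linear_order_on atoms \<omega> \<and> NBB \<omega> S)}"

definition rank_preserving_embedding ::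
  "('a::{finite,complete_lattice} \<Rightarrow> 'b::{finite,complete_lattice}) \<Rightarrow> bool"
  where "rank_preserving_embedding f \<longleftrightarrow>
    (\<forall>x y. x \<le> y \<longleftrightarrow> f x \<le> f y) \<and> (\<forall>x. lattice_rank (f x) = lattice_rank x)"

lemma lattice_rank_eq:
  fixes r :: "'a::{finite,complete_lattice} \<Rightarrow> nat"
  assumes r: "is_rank_function r"
  shows "lattice_rank = r"
  unfolding lattice_rank_def
proof (rule the_equality)
  fix s :: "'a \<Rightarrow> nat"
  assume s: "is_rank_function s"
  have "s x = r x" for x
  proof (induction "card {z. z < x}" arbitrary: x rule: less_induct)
    case less
    show ?case
    proof (cases "x = bot")
      case True
      then show ?thesis using r s by (simp add: is_rank_function_def)
    next
      case False
      then have "{z. z < x} \<noteq> {}" by (auto simp: bot.not_eq_extremum)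
      then obtain y where y: "y < x" and "\<forall>z \<in> {z. z < x}. y \<le> z \<longrightarrow> y = z"
        using finite_has_maximal[of "{z. z < x}"] by auto
      then have cov: "covers x y" unfolding covers_def by (metis less_le mem_Collect_eq)
      have "{z. z < y} \<subset> {z. z < x}" using y by auto
      then have "s y = r y" by (intro less) (simp add: psubset_card_mono)
      then show ?thesis using cov r s by (simp add: is_rank_function_def)
    qed
  qed
  then show "s = r" by blast
qed (fact r)

end

theory Submission
  imports Defs
begin

text \<open>
  In any finite lattice, a set \<open>S\<close> of atoms is NBB for some linear order iff every nonempty
  \<open>C \<subseteq> S\<close> has an element \<open>c\<close> that is not below the join of \<open>C - {c}\<close>: the smallest element of a
  set violating this bounds the others below, and conversely \<open>S\<close> can be built up by adding atoms
  not below the join so far, moving each new atom to the front of the order.  In a graded lattice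
  such a set has at most \<open>rank (\<Squnion>S)\<close> elements; in an atomic graded lattice every \<open>y\<close> has one with
  exactly \<open>rank y\<close> elements below it, to which any atom not below \<open>y\<close> may still be added.  In a
  geometric lattice every maximal such subset of a set \<open>T\<close> of atoms has \<open>rank (\<Squnion>T)\<close> elements,
  because joining an atom raises the rank by at most one.  Hence under (i) and (ii)
  \<open>f x = \<Squnion>{f' a | a \<le> x}\<close> preserves ranks and reflects the order.
\<close>

section \<open>Matroid closure\<close>

context matroid
begin

lemma finite_card_indep_subsets: "finite (card ` {I. I \<subseteq> X \<and> indep I})"
proof -
  have "{I. I \<subseteq> X \<and> indep I} \<subseteq> Pow E" using indep_subset_ground by auto
  then show ?thesis using finite_ground by (meson finite_Pow_iff finite_imageI finite_subset)
qed

lemma card_le_matroid_rank: "I \<subseteq> X \<Longrightarrow> indep I \<Longrightarrow> card I \<le> matroid_rank X"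
  unfolding matroid_rank_def by (intro Max_ge finite_card_indep_subsets) auto

lemma obtain_basis:
  obtains I where "I \<subseteq> X" "indep I" "card I = matroid_rank X"
proof -
  have "card ` {I. I \<subseteq> X \<and> indep I} \<noteq> {}" using indep_empty by auto
  from Max_in[OF finite_card_indep_subsets this] show ?thesis
    unfolding matroid_rank_def[symmetric] using that by auto
qed

lemma finite_indep: "indep I \<Longrightarrow> finite I"
  using indep_subset_ground finite_ground finite_subset by blast

lemma matroid_rank_mono:
  assumes "X \<subseteq> Y"
  shows "matroid_rank X \<le> matroid_rank Y"
proof -
  obtain I where "I \<subseteq> X" "indep I" "card I = matroid_rank X" by (rule obtain_basis)
  with assms show ?thesis using card_le_matroid_rank[of I Y] by auto
qed

lemma matroid_rank_insert_le: "matroid_rank (insert e X) \<le> matroid_rank X + 1"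
proof -
  obtain I where I: "I \<subseteq> insert e X" "indep I" "card I = matroid_rank (insert e X)"
    by (rule obtain_basis)
  have "card (I - {e}) \<le> matroid_rank X"
    using I by (intro card_le_matroid_rank) (auto intro: indep_hereditary)
  moreover have "card I \<le> card (I - {e}) + 1"
    by (auto simp: card_Diff_singleton_if)
  ultimately show ?thesis using I by simp
qed

lemma extend_basis:
  assumes "I \<subseteq> X" "indep I" "card I < matroid_rank X"
  obtains e where "e \<in> X - I" "indep (insert e I)"
proof -
  obtain K where "K \<subseteq> X" "indep K" "card K = matroid_rank X" by (rule obtain_basis)
  with assms show ?thesis using indep_augment[of I K] that by auto
qed

lemma extend_to_basis:
  assumes "I \<subseteq> X" "indep I"
  obtains J where "I \<subseteq> J" "J \<subseteq> X" "indep J" "card J = matroid_rank X"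
  using assms
proof (induction "matroid_rank X - card I" arbitrary: I thesis rule: less_induct)
  case less
  show ?case
  proof (cases "card I < matroid_rank X")
    case True
    obtain e where e: "e \<in> X - I" "indep (insert e I)"
      using extend_basis[OF less.prems(2,3) True] by blast
    have "card (insert e I) = card I + 1" using e finite_indep[OF less.prems(3)] by simp
    then have "matroid_rank X - card (insert e I) < matroid_rank X - card I" using True by simp
    then obtain J where "insert e I \<subseteq> J" "J \<subseteq> X" "indep J" "card J = matroid_rank X"
      using less.hyps[of "insert e I"] e less.prems(2) by auto
    then show ?thesis using less.prems(1)[of J] by simp
  next
    case False
    then have "card I = matroid_rank X"
      using card_le_matroid_rank[OF less.prems(2,3)] by simp
    then show ?thesis using less.prems by blast
  qed
qed

text \<open>Extend a basis \<open>I\<close> of \<open>X\<close> to a basis \<open>J\<close> of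
  \<open>F\<close>. If \<open>e\<close> raised the rank of \<open>F\<close>, the element augmenting
  \<open>J\<close> could only be \<open>e\<close>, so \<open>insert e I\<close> would be independent
  and too large for \<open>insert e X\<close>.\<close>

lemma matroid_rank_insert_eq_mono:
  assumes "X \<subseteq> F" and eq: "matroid_rank (insert e X) = matroid_rank X"
  shows "matroid_rank (insert e F) = matroid_rank F"
proof (rule ccontr)
  assume "matroid_rank (insert e F) \<noteq> matroid_rank F"
  then have lt: "matroid_rank F < matroid_rank (insert e F)"
    using matroid_rank_mono[OF subset_insertI, of F e] by simp
  obtain I where I: "I \<subseteq> X" "indep I" "card I = matroid_rank X" by (rule obtain_basis)
  obtain J where J: "I \<subseteq> J" "J \<subseteq> F" "indep J" "card J = matroid_rank F"
    using extend_to_basis[of I F] I assms(1) by auto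
  obtain k where k: "k \<in> insert e F - J" "indep (insert k J)"
    using extend_basis[of J "insert e F"] J lt by auto
  have "k \<notin> F"
    using card_le_matroid_rank[of "insert k J" F] J k finite_indep[of J] by auto
  with k have "k = e" by auto
  with k J have "indep (insert e I)" by (auto intro: indep_hereditary)
  then have "card (insert e I) \<le> matroid_rank X"
    using card_le_matroid_rank[of "insert e I" "insert e X"] I eq by auto
  moreover have "e \<notin> I" using \<open>k = e\<close> k J by auto
  ultimately show False using I finite_indep[of I] by simp
qed

text \<open>The usual matroid closure. Restricting to \<open>E\<close> matters: a point outside the
  ground set never changes the rank.\<close>

definition closure :: "'e set \<Rightarrow> 'e set"
  where "closure X = {e \<in> E. matroid_rank (insert e X) = matroid_rank X}"

lemma subset_closure: "X \<subseteq> E \<Longrightarrow> X \<subseteq> closure X"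
  by (auto simp: closure_def insert_absorb)

text \<open>Together with \<open>subset_closure\<close> and \<open>flat_closure\<close> this makes
  \<open>closure X\<close> the least flat containing \<open>X\<close>, for \<open>X\<close> inside
  \<open>E\<close>.\<close>

lemma closure_subset_flat:
  assumes "flat F" "X \<subseteq> F"
  shows "closure X \<subseteq> F"
proof
  fix e assume e: "e \<in> closure X"
  then have "matroid_rank (insert e F) = matroid_rank F"
    by (intro matroid_rank_insert_eq_mono[OF assms(2)]) (simp add: closure_def)
  then show "e \<in> F" using assms(1) e by (force simp: flat_def closure_def)
qed

text \<open>If the closure had larger rank, a basis of \<open>X\<close> could be augmented by a
  point of the closure, although no such point raises the rank of \<open>X\<close>.\<close>

lemma matroid_rank_closure:
  assumes "X \<subseteq> E"
  shows "matroid_rank (closure X) = matroid_rank X"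
proof (rule ccontr)
  assume "matroid_rank (closure X) \<noteq> matroid_rank X"
  then have lt: "matroid_rank X < matroid_rank (closure X)"
    using matroid_rank_mono[OF subset_closure[OF assms]] by auto
  obtain I where I: "I \<subseteq> X" "indep I" "card I = matroid_rank X" by (rule obtain_basis)
  obtain k where k: "k \<in> closure X - I" "indep (insert k I)"
    using extend_basis[of I "closure X"] I lt subset_closure[OF assms] by auto
  have "card (insert k I) \<le> matroid_rank (insert k X)"
    using I k by (intro card_le_matroid_rank) auto
  then show False using k I finite_indep[of I] by (simp add: closure_def)
qed

lemma flat_closure:
  assumes "X \<subseteq> E"
  shows "flat (closure X)"
  unfolding flat_def
proof (intro conjI ballI)
  show "closure X \<subseteq> E" by (auto simp: closure_def)
next
  fix e assume e: "e \<in> E - closure X"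
  have "matroid_rank X < matroid_rank (insert e X)"
    using e matroid_rank_mono[OF subset_insertI, of X e] by (auto simp: closure_def)
  also have "\<dots> \<le> matroid_rank (insert e (closure X))"
    using subset_closure[OF assms] by (intro matroid_rank_mono) auto
  finally show "matroid_rank (closure X) < matroid_rank (insert e (closure X))"
    using matroid_rank_closure[OF assms] by simp
qed

lemma matroid_rank_closure_insert:
  assumes "flat F" "e \<in> E - F"
  shows "matroid_rank (closure (insert e F)) = matroid_rank F + 1"
proof -
  have "matroid_rank F < matroid_rank (insert e F)" using assms by (simp add: flat_def)
  moreover have "matroid_rank (closure (insert e F)) = matroid_rank (insert e F)"
    using assms by (intro matroid_rank_closure) (auto simp: flat_def)
  ultimately show ?thesis using matroid_rank_insert_le[of e F] by simp
qed

end

section \<open>Rank functions\<close>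

lemma atom_eqI: "a \<in> atoms \<Longrightarrow> b \<le> a \<Longrightarrow> b \<noteq> bot \<Longrightarrow> b = a"
  unfolding atoms_def covers_def by (auto simp: bot.not_eq_extremum less_le)

lemma atom_not_bot: "a \<in> atoms \<Longrightarrow> a \<noteq> bot"
  by (auto simp: atoms_def covers_def)

text \<open>Finiteness gives a minimal element above \<open>x\<close> that is at most
  \<open>y\<close>. It covers \<open>x\<close>, so the rank jumps there and does not fall
  afterwards.\<close>

lemma rank_function_strict_mono:
  fixes r :: "'a::{finite,complete_lattice} \<Rightarrow> nat"
  assumes r: "is_rank_function r" and "x < y"
  shows "r x < r y"
proof -
  have "y \<in> {z. x < z}" using assms by simp
  then obtain z where z: "x < z" "z \<le> y" "\<forall>w \<in> {z. x < z}. w \<le> z \<longrightarrow> z = w"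
    using finite_has_minimal2[of "{z. x < z}" y] by auto
  then have "covers z x" unfolding covers_def by (metis less_le mem_Collect_eq)
  then have "r z = r x + 1" "r z \<le> r y"
    using r monoD[of r z y] z by (auto simp: is_rank_function_def)
  then show ?thesis by simp
qed

lemma obtain_lower_cover:
  fixes y :: "'a::{finite,complete_lattice}"
  assumes "y \<noteq> bot"
  obtains x where "covers y x"
proof -
  have "bot \<in> {z. z < y}" using assms by (simp add: bot.not_eq_extremum)
  then obtain x where "x < y" "\<forall>z \<in> {z. z < y}. x \<le> z \<longrightarrow> x = z"
    using finite_has_maximal[of "{z. z < y}"] by auto
  then have "covers y x" unfolding covers_def by (metis less_le mem_Collect_eq)
  then show ?thesis by (rule that)
qed

text \<open>The matroid rank of the flat \<open>\<phi> x\<close> serves as the rank of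
  \<open>x\<close>. The second property is semimodularity in the form used later.\<close>

lemma geometric_lattice_rank:
  assumes "geometric_lattice TYPE('b::{finite,complete_lattice})"
  obtains r :: "'b::{finite,complete_lattice} \<Rightarrow> nat" where "is_rank_function r"
    and "\<And>x a. a \<in> atoms \<Longrightarrow> r (sup x a) \<le> r x + 1"
proof -
  from assms obtain E :: "nat set" and indep and \<phi> :: "'b \<Rightarrow> nat set"
    where "simple_matroid E indep"
      and bij: "bij_betw \<phi> UNIV {F. matroid.flat E indep F}"
      and le: "\<And>x y. x \<le> y \<longleftrightarrow> \<phi> x \<subseteq> \<phi> y"
    unfolding geometric_lattice_def by blast
  then interpret simple_matroid E indep by simp
  have flat_phi: "flat (\<phi> x)" for x using bij_betw_apply[OF bij, of x] by simp
  then have sub: "\<phi> x \<subseteq> E" for x by (simp add: flat_def)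
  have ex: "\<exists>z. \<phi> z = F" if "flat F" for F
    using bij that unfolding bij_betw_def by (metis mem_Collect_eq rangeE)
  define r where "r x = matroid_rank (\<phi> x)" for x
  \<comment> \<open>Adding a point outside a flat and closing again climbs exactly one rank. That
    every cover arises in this way is the next claim.\<close>
  have step: "\<exists>z. \<phi> z = closure (insert e (\<phi> x)) \<and> x < z \<and> r z = r x + 1"
    if e: "e \<in> E - \<phi> x" for x e
  proof -
    have ins: "insert e (\<phi> x) \<subseteq> E" using e sub by auto
    obtain z where z: "\<phi> z = closure (insert e (\<phi> x))" using ex[OF flat_closure[OF ins]] by auto
    have "insert e (\<phi> x) \<subseteq> \<phi> z" using subset_closure[OF ins] z by simp
    then have "x < z" using e le[of x z] le[of z x] by (auto simp: less_le_not_le)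
    then show ?thesis using matroid_rank_closure_insert[OF flat_phi e] z by (auto simp: r_def)
  qed
  \<comment> \<open>The flat generated by \<open>\<phi> x\<close> and any point \<open>e\<close> of
    \<open>\<phi> y\<close> outside it lies strictly above \<open>x\<close> and is at most
    \<open>y\<close>, so covering forces it to be \<open>\<phi> y\<close>.\<close>
  have cover: "\<phi> y = closure (insert e (\<phi> x)) \<and> r y = r x + 1"
    if cov: "covers y x" and e: "e \<in> \<phi> y - \<phi> x" for x y e
  proof -
    obtain z where z: "\<phi> z = closure (insert e (\<phi> x))" "x < z" "r z = r x + 1"
      using step[of e x] e sub[of y] by blast
    have "insert e (\<phi> x) \<subseteq> \<phi> y"
      using cov e le[of x y] by (auto simp: covers_def)
    then have "z \<le> y" using closure_subset_flat[OF flat_phi] z le by simp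
    then have "z = y" using cov z by (auto simp: covers_def less_le)
    with z show ?thesis by simp
  qed
  have cover_ex: "\<exists>e. e \<in> \<phi> y - \<phi> x" if "covers y x" for x y
    using that le[of y x] by (auto simp: covers_def less_le_not_le)
  have "is_rank_function r"
    unfolding is_rank_function_def
  proof (intro conjI allI impI)
    obtain z where z: "\<phi> z = closure {}" using ex[OF flat_closure[of "{}"]] by auto
    have "r bot \<le> r z" unfolding r_def using le[of bot z] by (intro matroid_rank_mono) simp
    moreover have "r z = 0"
      using matroid_rank_closure[of "{}"] z obtain_basis[of "{}"] unfolding r_def
      by (metis card.empty empty_subsetI subset_empty)
    ultimately show "r bot = 0" by simp
    show "mono r" unfolding r_def by (intro monoI matroid_rank_mono) (simp add: le)
    show "r y = r x + 1" if "covers y x" for x y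
      using cover[OF that] cover_ex[OF that] by blast
  qed
  moreover have "r (sup x a) \<le> r x + 1" if a: "a \<in> atoms" for x a
  proof (cases "a \<le> x")
    case True
    then show ?thesis by (simp add: sup_absorb1)
  next
    case False
    have cov: "covers a bot" using a by (simp add: atoms_def)
    \<comment> \<open>A point of \<open>a\<close> outside \<open>x\<close> is also outside
      \<open>bot\<close>, so it generates \<open>a\<close> over \<open>bot\<close>. Hence the flat
      generated by \<open>x\<close> and this single point already contains \<open>a\<close>.\<close>
    obtain e where e: "e \<in> \<phi> a - \<phi> x" using False le by auto
    have "\<phi> bot \<subseteq> \<phi> x" using le[of bot x] by simp
    then have phi_a: "\<phi> a = closure (insert e (\<phi> bot))" using cover[OF cov, of e] e by auto
    obtain z where z: "\<phi> z = closure (insert e (\<phi> x))" "x < z" "r z = r x + 1"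
      using step[of e x] e sub[of a] by blast
    have "insert e (\<phi> bot) \<subseteq> insert e (\<phi> x)" using \<open>\<phi> bot \<subseteq> \<phi> x\<close> by auto
    also have "\<dots> \<subseteq> \<phi> z" using subset_closure[of "insert e (\<phi> x)"] e sub z by auto
    finally have "\<phi> a \<subseteq> \<phi> z" unfolding phi_a by (rule closure_subset_flat[OF flat_phi])
    then have "sup x a \<le> z" using z(2) le[of a z] by simp
    then have "r (sup x a) \<le> r z" unfolding r_def using le by (intro matroid_rank_mono) simp
    then show ?thesis using z by simp
  qed
  ultimately show ?thesis by (rule that)
qed

section \<open>Sets of atoms that are NBB for some order\<close>

text \<open>Makes \<open>a\<close> the least element and keeps the order among the others.
  Reflexivity at \<open>a\<close> comes from the pair \<open>(a, a)\<close> in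
  \<open>{a} \<times> A\<close>.\<close>

lemma linear_order_on_move_to_front:
  assumes "linear_order_on A \<omega>" "a \<in> A"
  shows "linear_order_on A ({a} \<times> A \<union> {(x, y) \<in> \<omega>. x \<noteq> a \<and> y \<noteq> a})"
  using assms
  unfolding linear_order_on_def partial_order_on_def preorder_on_def refl_on_def trans_def
    antisym_def total_on_def
  by (intro conjI; blast)

lemma NBB_sets_subset_atoms: "S \<in> NBB_sets \<Longrightarrow> S \<subseteq> atoms"
  by (simp add: NBB_sets_def)

lemma empty_NBB_sets: "{} \<in> NBB_sets"
proof -
  obtain \<omega> :: "'a rel" where "well_order_on atoms \<omega>" using well_order_on by blast
  then show ?thesis
    unfolding NBB_sets_def NBB_def bounded_below_def well_order_on_def by auto
qed

lemma NBB_sets_subset: "S \<in> NBB_sets \<Longrightarrow> T \<subseteq> S \<Longrightarrow> T \<in> NBB_sets"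
  unfolding NBB_sets_def NBB_def mem_Collect_eq by (meson order_trans)

text \<open>After \<open>a\<close> is moved to the front, no set containing \<open>a\<close> is
  bounded below, because nothing is smaller than \<open>a\<close>. A subset of \<open>S\<close>
  could gain only \<open>a\<close> as a new bound, and \<open>a\<close> is not below its
  join.\<close>

lemma NBB_sets_insert:
  assumes "S \<in> NBB_sets" and a: "a \<in> atoms" "\<not> a \<le> Sup S"
  shows "insert a S \<in> NBB_sets"
proof -
  obtain \<omega> where lin: "linear_order_on atoms \<omega>" and nbb: "NBB \<omega> S"
    using assms(1) by (auto simp: NBB_sets_def)
  define \<omega>' where "\<omega>' = {a} \<times> atoms \<union> {(x, y) \<in> \<omega>. x \<noteq> a \<and> y \<noteq> a}"
  have False if D: "D \<subseteq> insert a S" "bounded_below \<omega>' D" for D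
  proof -
    obtain b where b: "b \<in> atoms" "\<forall>d \<in> D. (b, d) \<in> \<omega>' \<and> b \<noteq> d" "b \<le> Sup D"
      using D(2) by (auto simp: bounded_below_def)
    have "a \<notin> D" using b by (auto simp: \<omega>'_def)
    then have DS: "D \<subseteq> S" using D(1) by auto
    then have "b \<noteq> a" using b(3) a(2) Sup_subset_mono[OF DS] by auto
    then have "bounded_below \<omega> D"
      using b D(2) by (auto simp: bounded_below_def \<omega>'_def)
    then show False using nbb DS by (auto simp: NBB_def)
  qed
  moreover have "linear_order_on atoms \<omega>'"
    unfolding \<omega>'_def using lin a(1) by (rule linear_order_on_move_to_front)
  ultimately show ?thesis
    using a(1) NBB_sets_subset_atoms[OF assms(1)] unfolding NBB_sets_def NBB_def by blast
qed

text \<open>Removes the choice of a linear order. What remains is a condition on joins, which can be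
  carried along a map between lattices.\<close>

lemma NBB_sets_iff:
  fixes S :: "'a::{finite,complete_lattice} set"
  assumes "S \<subseteq> atoms"
  shows "S \<in> NBB_sets \<longleftrightarrow> (\<forall>C \<subseteq> S. C \<noteq> {} \<longrightarrow> (\<exists>c \<in> C. \<not> c \<le> Sup (C - {c})))"
proof (intro iffI allI impI)
  fix C
  assume "S \<in> NBB_sets" and C: "C \<subseteq> S" "C \<noteq> {}"
  then obtain \<omega> where lin: "linear_order_on atoms \<omega>" and nbb: "NBB \<omega> S"
    by (auto simp: NBB_sets_def)
  have at: "C \<subseteq> atoms" using C assms by simp
  have "\<exists>m \<in> C. \<forall>x \<in> C. (m, x) \<in> \<omega>"
    using finite[of C] C(2) at
  proof (induction rule: finite_ne_induct)
    case (singleton x)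
    then show ?case using lin by (auto simp: order_on_defs refl_on_def)
  next
    case (insert x F)
    then obtain m where m: "m \<in> F" "\<forall>y \<in> F. (m, y) \<in> \<omega>" by auto
    have "(m, x) \<in> \<omega> \<or> (x, m) \<in> \<omega>" "(x, x) \<in> \<omega>" "trans \<omega>"
      using lin insert.prems insert.hyps m(1)
      by (auto simp: order_on_defs refl_on_def total_on_def)
    then show ?case using m by (auto dest: transD)
  qed
  then obtain m where m: "m \<in> C" "\<forall>x \<in> C. (m, x) \<in> \<omega>" by auto
  have "\<not> m \<le> Sup (C - {m})"
  proof
    assume le: "m \<le> Sup (C - {m})"
    \<comment> \<open>\<open>bounded_below\<close> asks for a nonempty set. Were \<open>C\<close>
      just \<open>{m}\<close>, the atom \<open>m\<close> would lie below
      \<open>Sup {} = bot\<close>.\<close>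
    then have "C - {m} \<noteq> {}" using m(1) at atom_not_bot
      by (metis Sup_empty bot_unique subsetD)
    then have "bounded_below \<omega> (C - {m})"
      using le m at by (auto simp: bounded_below_def)
    moreover have "C - {m} \<subseteq> S" using C by auto
    ultimately show False using nbb by (simp add: NBB_def)
  qed
  then show "\<exists>c \<in> C. \<not> c \<le> Sup (C - {c})" using m by blast
next
  assume "\<forall>C \<subseteq> S. C \<noteq> {} \<longrightarrow> (\<exists>c \<in> C. \<not> c \<le> Sup (C - {c}))"
  with finite[of S] assms show "S \<in> NBB_sets"
  proof (induction S rule: finite_psubset_induct)
    case (psubset S)
    show ?case
    proof (cases "S = {}")
      case True
      then show ?thesis by (simp add: empty_NBB_sets)
    next
      case False
      \<comment> \<open>The condition for \<open>C = S\<close> selects the atom to be added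
        last.\<close>
      then obtain c where c: "c \<in> S" "\<not> c \<le> Sup (S - {c})" using psubset.prems by blast
      have "S - {c} \<in> NBB_sets"
      proof (rule psubset.IH)
        show "S - {c} \<subset> S" "S - {c} \<subseteq> atoms" using c(1) psubset.prems(1) by auto
        show "\<forall>C \<subseteq> S - {c}. C \<noteq> {} \<longrightarrow> (\<exists>c \<in> C. \<not> c \<le> Sup (C - {c}))"
          using psubset.prems(2) by (meson Diff_subset order_trans)
      qed
      from NBB_sets_insert[OF this _ c(2)] c(1) psubset.prems(1) show ?thesis
        by (auto simp: insert_absorb)
    qed
  qed
qed

text \<open>Some \<open>c\<close> in \<open>S\<close> is not below the join of the others. Removing
  it lowers the join strictly, hence the rank by at least one, while the cardinality falls by
  exactly one.\<close>

lemma NBB_sets_card_le_rank: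
  fixes r :: "'a::{finite,complete_lattice} \<Rightarrow> nat"
  assumes r: "is_rank_function r" and "S \<in> NBB_sets"
  shows "card S \<le> r (Sup S)"
  using finite[of S] assms(2)
proof (induction S rule: finite_psubset_induct)
  case (psubset S)
  show ?case
  proof (cases "S = {}")
    case False
    have S: "\<forall>C \<subseteq> S. C \<noteq> {} \<longrightarrow> (\<exists>c \<in> C. \<not> c \<le> Sup (C - {c}))"
      using psubset.prems NBB_sets_iff NBB_sets_subset_atoms by blast
    then obtain c where c: "c \<in> S" "\<not> c \<le> Sup (S - {c})" using False by blast
    have "S - {c} \<in> NBB_sets"
      using NBB_sets_subset[OF psubset.prems] by blast
    then have "card (S - {c}) \<le> r (Sup (S - {c}))" using c(1) by (intro psubset.IH) auto
    moreover have "Sup (S - {c}) < Sup S"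
      using c Sup_upper[OF c(1)] Sup_subset_mono[of "S - {c}" S] by (metis Diff_subset less_le)
    then have "r (Sup (S - {c})) < r (Sup S)" by (rule rank_function_strict_mono[OF r])
    moreover have "card S = Suc (card (S - {c}))" using card.remove[OF finite c(1)] .
    ultimately show ?thesis by simp
  qed simp
qed

section \<open>Realizing ranks by NBB sets\<close>

lemma atomic_obtain_atom:
  fixes x y :: "'a::{finite,complete_lattice}"
  assumes "atomic_lattice TYPE('a)" "\<not> y \<le> x"
  obtains a where "a \<in> atoms" "a \<le> y" "\<not> a \<le> x"
proof -
  obtain S where "S \<subseteq> atoms" "y = Sup S" using assms(1) unfolding atomic_lattice_def by blast
  then show ?thesis using assms(2) that by (metis Sup_le_iff Sup_upper subsetD)
qed

text \<open>The set grows along a chain of covers from \<open>bot\<close> to \<open>y\<close>. When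
  \<open>y\<close> covers \<open>x\<close>, an atom below \<open>y\<close> but not below
  \<open>x\<close> is not below \<open>Sup I\<close> either, so inserting it keeps the set NBB and
  the count in step with the rank.\<close>

lemma atomic_NBB_set_of_rank:
  fixes r :: "'a::{finite,complete_lattice} \<Rightarrow> nat"
  assumes atomic: "atomic_lattice TYPE('a)" and r: "is_rank_function r"
  shows "\<exists>I \<in> NBB_sets. Sup I \<le> y \<and> card I = r y"
proof (induction "r y" arbitrary: y rule: less_induct)
  case less
  show ?case
  proof (cases "y = bot")
    case True
    then show ?thesis
      using r empty_NBB_sets by (intro bexI[of _ "{}"]) (auto simp: is_rank_function_def)
  next
    case False
    then obtain x where x: "covers y x" by (rule obtain_lower_cover)
    then have ry: "r y = r x + 1" and "x < y"
      using r by (auto simp: is_rank_function_def covers_def)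
    then obtain I where I: "I \<in> NBB_sets" "Sup I \<le> x" "card I = r x" using less by fastforce
    obtain a where a: "a \<in> atoms" "a \<le> y" "\<not> a \<le> x"
      using atomic_obtain_atom[OF atomic, of y x] \<open>x < y\<close> by (auto simp: less_le_not_le)
    have "insert a I \<in> NBB_sets" using I a by (intro NBB_sets_insert) auto
    moreover have "a \<notin> I" using I(2) a(3) by (auto simp: Sup_le_iff)
    moreover have "Sup (insert a I) \<le> y" using I(2) a(2) \<open>x < y\<close> by auto
    ultimately show ?thesis using I(3) ry by (intro bexI[of _ "insert a I"]) auto
  qed
qed

text \<open>In an inclusion-maximal NBB subset of \<open>T\<close>, the join bounds every
  \<open>t\<close> in \<open>T\<close>, since otherwise \<open>NBB_sets_insert\<close> would enlarge
  the set. By \<open>step\<close>, the rank of that join is at most the number of elements.\<close>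

lemma semimodular_NBB_subset_of_rank:
  fixes r :: "'a::{finite,complete_lattice} \<Rightarrow> nat"
  assumes r: "is_rank_function r"
    and step: "\<And>x a. a \<in> atoms \<Longrightarrow> r (sup x a) \<le> r x + 1"
    and T: "T \<subseteq> atoms"
  shows "\<exists>A \<subseteq> T. A \<in> NBB_sets \<and> r (Sup T) \<le> card A"
proof -
  have le: "r (Sup A) \<le> card A" if "A \<subseteq> atoms" for A
    using finite[of A] that
  proof (induction A rule: finite_induct)
    case empty
    then show ?case using r by (simp add: is_rank_function_def)
  next
    case (insert a A)
    then show ?case using step[of a "Sup A"] by (simp add: sup_commute)
  qed
  have "{A. A \<subseteq> T \<and> A \<in> NBB_sets} \<noteq> {}" using empty_NBB_sets by auto
  from finite_has_maximal[OF finite this]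
  obtain A where A: "A \<subseteq> T" "A \<in> NBB_sets"
    and max: "\<And>B. B \<subseteq> T \<Longrightarrow> B \<in> NBB_sets \<Longrightarrow> A \<subseteq> B \<Longrightarrow> A = B"
    by (metis (no_types, lifting) mem_Collect_eq)
  have "t \<le> Sup A" if "t \<in> T" for t
  proof (rule ccontr)
    assume t: "\<not> t \<le> Sup A"
    then have "insert t A \<in> NBB_sets" using A(2) T that by (intro NBB_sets_insert) auto
    then have "A = insert t A" using A(1) that by (intro max) auto
    then show False using t Sup_upper[of t A] by auto
  qed
  then have "Sup T \<le> Sup A" by (rule Sup_least)
  then have "r (Sup T) \<le> r (Sup A)" using r by (simp add: is_rank_function_def monoD)
  also have "\<dots> \<le> card A" using le A T by auto
  finally show ?thesis using A by blast
qed

section \<open>The extension criterion\<close>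

theorem theorem3p7:
  fixes f' :: "'a::{finite,complete_lattice} \<Rightarrow> 'b::{finite,complete_lattice}"
  assumes "atomic_lattice TYPE('a)"
    and "graded_lattice TYPE('a)"
    and "geometric_lattice TYPE('b)"
    and "lattice_rank (top :: 'b) = lattice_rank (top :: 'a)"
    and "bij_betw f' (atoms :: 'a set) (atoms :: 'b set)"
  shows "(\<exists>f :: 'a \<Rightarrow> 'b. rank_preserving_embedding f \<and> (\<forall>a \<in> atoms. f a = f' a)) \<longleftrightarrow>
    (\<forall>I \<in> (NBB_sets :: 'a set set). f' ` I \<in> (NBB_sets :: 'b set set)) \<and>
    (\<forall>A \<subseteq> (atoms :: 'a set). card A > lattice_rank (Sup A) \<longrightarrow>
       f' ` A \<notin> (NBB_sets :: 'b set set))"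
proof -
  obtain r :: "'a \<Rightarrow> nat" where r: "is_rank_function r"
    using assms(2) unfolding graded_lattice_def by blast
  obtain s :: "'b \<Rightarrow> nat" where s: "is_rank_function s"
    and s_step: "\<And>x a. a \<in> atoms \<Longrightarrow> s (sup x a) \<le> s x + 1"
    using geometric_lattice_rank[OF assms(3)] by blast
  have s_mono: "x \<le> y \<Longrightarrow> s x \<le> s y" for x y using s by (simp add: is_rank_function_def monoD)
  have r_mono: "x \<le> y \<Longrightarrow> r x \<le> r y" for x y using r by (simp add: is_rank_function_def monoD)
  have inj: "inj_on f' atoms" and img: "f' ` atoms = atoms"
    using assms(5) by (auto simp: bij_betw_def)
  have card_img: "card (f' ` A) = card A" if "A \<subseteq> atoms" for A
    using inj_on_subset[OF inj that] by (rule card_image)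
  show ?thesis
    \<comment> \<open>Rank functions are unique, so \<open>lattice_rank\<close> may be read as
      \<open>r\<close> on the domain and as \<open>s\<close>, with its semimodular step, on the
      codomain.\<close>
    unfolding rank_preserving_embedding_def lattice_rank_eq[OF r] lattice_rank_eq[OF s]
  proof (intro iffI)
    assume "\<exists>f. ((\<forall>x y. (x \<le> y) = (f x \<le> f y)) \<and> (\<forall>x. s (f x) = r x)) \<and> (\<forall>a\<in>atoms. f a = f' a)"
    then obtain f where le: "\<And>x y. x \<le> y \<longleftrightarrow> f x \<le> f y" and rank: "\<And>x. s (f x) = r x"
      and ext: "\<And>a. a \<in> atoms \<Longrightarrow> f a = f' a" by blast
    \<comment> \<open>Only an inequality: an order embedding need not preserve joins, but
      \<open>f (Sup A)\<close> is an upper bound of the images.\<close>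
    have Sup_le: "Sup (f' ` A) \<le> f (Sup A)" if A: "A \<subseteq> atoms" for A
    proof (rule Sup_least)
      fix b assume "b \<in> f' ` A"
      then obtain a where "a \<in> A" "b = f a" using A ext by fastforce
      then show "b \<le> f (Sup A)" using le[of a "Sup A"] Sup_upper[of a A] by simp
    qed
    show "(\<forall>I\<in>NBB_sets. f' ` I \<in> NBB_sets) \<and>
      (\<forall>A\<subseteq>atoms. r (Sup A) < card A \<longrightarrow> f' ` A \<notin> NBB_sets)"
    proof (intro conjI ballI allI impI)
      fix I :: "'a set"
      assume I: "I \<in> NBB_sets"
      then have at: "I \<subseteq> atoms" by (rule NBB_sets_subset_atoms)
      \<comment> \<open>The criterion of \<open>NBB_sets_iff\<close> is pulled back to a set
        \<open>C\<close> of atoms of the domain. Its witness \<open>c\<close> survives because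
        \<open>f\<close> reflects the order and the join of images is at most the image of the
        join.\<close>
      have "\<exists>d\<in>D. \<not> d \<le> Sup (D - {d})" if D: "D \<subseteq> f' ` I" "D \<noteq> {}" for D
      proof -
        obtain C where C: "C \<subseteq> I" "D = f' ` C" using D(1) by (auto simp: subset_image_iff)
        then obtain c where c: "c \<in> C" "\<not> c \<le> Sup (C - {c})"
          using I D(2) NBB_sets_iff[OF at] by blast
        have "D - {f' c} = f' ` (C - {c})"
          using inj_on_image_set_diff[OF inj, of C "{c}"] C c at by auto
        moreover have "C - {c} \<subseteq> atoms" using C at by auto
        ultimately have "Sup (D - {f' c}) \<le> f (Sup (C - {c}))" using Sup_le by simp
        moreover have "\<not> f' c \<le> f (Sup (C - {c}))" using c C at le ext[of c] by auto
        ultimately have "\<not> f' c \<le> Sup (D - {f' c})" by (meson order_trans)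
        then show ?thesis using C c by blast
      qed
      then show "f' ` I \<in> NBB_sets" using at img by (subst NBB_sets_iff) auto
    next
      fix A :: "'a set"
      assume A: "A \<subseteq> atoms" "r (Sup A) < card A"
      then have "s (Sup (f' ` A)) < card (f' ` A)"
        using s_mono[OF Sup_le[OF A(1)]] rank card_img by simp
      then show "f' ` A \<notin> NBB_sets" using NBB_sets_card_le_rank[OF s, of "f' ` A"] by auto
    qed
  next
    assume "(\<forall>I\<in>NBB_sets. f' ` I \<in> NBB_sets) \<and>
      (\<forall>A\<subseteq>atoms. r (Sup A) < card A \<longrightarrow> f' ` A \<notin> NBB_sets)"
    then have i: "\<And>I. I \<in> NBB_sets \<Longrightarrow> f' ` I \<in> NBB_sets"
      and ii: "\<And>A. A \<subseteq> atoms \<Longrightarrow> r (Sup A) < card A \<Longrightarrow> f' ` A \<notin> NBB_sets" by blast+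
    \<comment> \<open>The join below is the smallest value that an order-preserving extension of
      \<open>f'\<close> can take at \<open>x\<close>.\<close>
    define f where "f x = Sup (f' ` {a \<in> atoms. a \<le> x})" for x
    have mono: "f x \<le> f y" if "x \<le> y" for x y
      unfolding f_def using that by (intro Sup_subset_mono) auto
    have atom_le: "f' a \<le> f x" if "a \<in> atoms" "a \<le> x" for a x
      unfolding f_def using that by (intro Sup_upper) auto
    \<comment> \<open>Condition (i) enters here: NBB sets of the domain give lower bounds for ranks
      in the codomain.\<close>
    have card_le: "card I \<le> s (f x)" if I: "I \<in> NBB_sets" and le: "\<forall>a \<in> I. f' a \<le> f x" for I x
    proof -
      have "card (f' ` I) \<le> s (Sup (f' ` I))" using NBB_sets_card_le_rank[OF s] i I by blast
      also have "\<dots> \<le> s (f x)" using le by (intro s_mono Sup_least) auto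
      finally show ?thesis using card_img[OF NBB_sets_subset_atoms[OF I]] by simp
    qed
    \<comment> \<open>Condition (ii) enters here. A rank above \<open>r x\<close> would yield an NBB
      set of more than \<open>r x\<close> images of atoms below \<open>x\<close>, whose preimage
      \<open>A\<close> has \<open>Sup A \<le> x\<close> and so is too large for its rank.\<close>
    have upper: "s (f x) \<le> r x" for x
    proof (rule ccontr)
      assume less: "\<not> s (f x) \<le> r x"
      obtain B where B: "B \<subseteq> f' ` {a \<in> atoms. a \<le> x}" "B \<in> NBB_sets" "s (f x) \<le> card B"
        using semimodular_NBB_subset_of_rank[OF s s_step, of "f' ` {a \<in> atoms. a \<le> x}"] img
        unfolding f_def by blast
      then obtain A where A: "A \<subseteq> {a \<in> atoms. a \<le> x}" "B = f' ` A" by (auto simp: subset_image_iff)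
      then have at: "A \<subseteq> atoms" by auto
      have "r (Sup A) \<le> r x" using A(1) by (intro r_mono Sup_least) auto
      then have "r (Sup A) < card A" using less B(3) A(2) card_img[OF at] by simp
      then show False using ii[OF at] A(2) B(2) by simp
    qed
    have basis: "\<exists>I \<in> NBB_sets. Sup I \<le> x \<and> card I = r x \<and> (\<forall>a \<in> I. f' a \<le> f x)" for x
    proof -
      obtain I where I: "I \<in> NBB_sets" "Sup I \<le> x" "card I = r x"
        using atomic_NBB_set_of_rank[OF assms(1) r] by blast
      then have "\<forall>a \<in> I. f' a \<le> f x"
        using NBB_sets_subset_atoms[OF I(1)] by (auto simp: Sup_le_iff intro!: atom_le)
      with I show ?thesis by blast
    qed
    have rank: "s (f x) = r x" for x
      using basis[of x] card_le upper[of x] by (metis order_antisym)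
    \<comment> \<open>If \<open>a\<close> were not below \<open>y\<close>, it could be added to an
      NBB set of \<open>r y\<close> atoms below \<open>y\<close>. All images would still lie below
      \<open>f y\<close>, forcing its rank to be at least \<open>r y + 1\<close>, against
      \<open>upper\<close>.\<close>
    have atom_reflect: "a \<le> y" if a: "a \<in> atoms" "f' a \<le> f y" for a y
    proof (rule ccontr)
      assume nle: "\<not> a \<le> y"
      obtain I where I: "I \<in> NBB_sets" "Sup I \<le> y" "card I = r y" "\<forall>a \<in> I. f' a \<le> f y"
        using basis by blast
      have "\<not> a \<le> Sup I" using nle I(2) by auto
      then have "insert a I \<in> NBB_sets" "a \<notin> I"
        using I(1) a(1) NBB_sets_insert Sup_upper by auto
      then have "r y + 1 \<le> s (f y)" using card_le[of "insert a I" y] I a by simp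
      then show False using upper[of y] by simp
    qed
    have reflect: "x \<le> y" if "f x \<le> f y" for x y
    proof (rule ccontr)
      assume "\<not> x \<le> y"
      then obtain a where a: "a \<in> atoms" "a \<le> x" "\<not> a \<le> y"
        using atomic_obtain_atom[OF assms(1)] by blast
      have "f' a \<le> f y" using atom_le[OF a(1,2)] that by (rule order_trans)
      then show False using atom_reflect a by blast
    qed
    have le_iff: "x \<le> y \<longleftrightarrow> f x \<le> f y" for x y using mono reflect by blast
    have "f a = f' a" if "a \<in> atoms" for a
    proof -
      \<comment> \<open>An atom has no other atom below it, so the join defining \<open>f a\<close>
        has the single term \<open>f' a\<close>.\<close>
      have "{b \<in> atoms. b \<le> a} = {a}" using that atom_eqI[OF that] atom_not_bot by auto
      then show ?thesis by (simp add: f_def)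
    qed
    then show "\<exists>f. ((\<forall>x y. (x \<le> y) = (f x \<le> f y)) \<and> (\<forall>x. s (f x) = r x)) \<and> (\<forall>a\<in>atoms. f a = f' a)"
      by (intro exI[of _ f] conjI allI ballI le_iff rank)
  qed
qed

end
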